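(* Let $p$ be a prime and let $Y \in \mathcal{C}(\mathbb{Z}_p)$. Then for any $p$-integral rational number $r \in \mathbb{Q} \cap \mathbb{Z}_p$, the additively shifted set $$Y + r := \{ y + r : y \in Y\}$$ satisfies $Y + r \in \mathcal{C}(\mathbb{Z}_p)$.
   Context: Let $\mathcal{A}$ be a finite alphabet and $\mathbb{N}=\{0,1,2,\dots\}$. A pointed labeled graph $(\mathcal{G},v)$ over $\mathcal{A}$ consists of a finite directed graph (loops and multiple edges allowed) whose edges are labeled by elements of $\mathcal{A}$, with a marked vertex $v$. Its path set $X_{\mathcal{G}}(v) \subset \mathcal{A}^{\mathbb{N}}$ is the set of label sequences of all one-sided infinite directed walks in $\mathcal{G}$ starting at $v$. Given a digit assignment map $\bar f_p: \mathcal{A} \to \{0,1,\dots,p-1\}$ (not necessarily injective), let $f_p: \mathcal{A}^{\mathbb{N}} \to \mathbb{Z}_p$, $f_p(a_0a_1a_2\cdots) = \sum_{k\ge 0} \bar f_p(a_k)p^k$. A $p$-adic path set fractal is a set of the form $Y = f_p(X_{\mathcal{G}}(v)) \subset \mathbb{Z}_p$ for some such data $(\bar f_p,\mathcal{G},v)$. $\mathcal{C}(\mathbb{Z}_p)$ denotes the collection of all $p$-adic path set fractals. *)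

theory Defs
  imports
    "HOL-Library.FuncSet"
    "HOL-Number_Theory.Cong"
    "HOL-Algebra.Ring"
    "Graph_Theory.Digraph"
begin

section \<open>The ring of p-adic integers\<close>

text \<open>
  The ring of p-adic integers is the inverse limit of the rings of integers modulo \<open>p ^ n\<close>:
  the component \<open>x n\<close> is the residue of the p-adic integer \<open>x\<close> modulo \<open>p ^ n\<close>.
\<close>

definition Zp :: "nat \<Rightarrow> (nat \<Rightarrow> int) ring" where
  "Zp p = \<lparr>carrier = {x. \<forall>n. x n \<in> {0..<int p ^ n} \<and> x (Suc n) mod int p ^ n = x n},
           monoid.mult = (\<lambda>x y n. (x n * y n) mod int p ^ n),
           one = (\<lambda>n. 1 mod int p ^ n),
           zero = (\<lambda>n. 0),
           add = (\<lambda>x y n. (x n + y n) mod int p ^ n)\<rparr>"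

definition Zp_of_int :: "nat \<Rightarrow> int \<Rightarrow> nat \<Rightarrow> int" where
  "Zp_of_int p a = (\<lambda>n. a mod int p ^ n)"

definition p_integral :: "nat \<Rightarrow> rat \<Rightarrow> bool" where
  "p_integral p r \<longleftrightarrow> \<not> int p dvd snd (quotient_of r)"

text \<open>
  The embedding of the p-integral rationals. The value is only meaningful if \<open>p_integral p r\<close>
  holds, since otherwise the denominator is not a unit; see \<open>Zp_rational_iff\<close> below.
\<close>

definition Zp_of_rat :: "nat \<Rightarrow> rat \<Rightarrow> nat \<Rightarrow> int" where
  "Zp_of_rat p r =
     Zp_of_int p (fst (quotient_of r)) \<otimes>\<^bsub>Zp p\<^esub> inv\<^bsub>Zp p\<^esub> Zp_of_int p (snd (quotient_of r))"


section \<open>Path sets and p-adic path set fractals\<close>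

text \<open>
  The digraphs of \<open>Graph_Theory\<close> have an explicit set of arcs and thus allow loops and
  multiple arcs.
\<close>

definition pointed_labeled_graph ::
    "'a set \<Rightarrow> ('v, 'e) pre_digraph \<Rightarrow> ('e \<Rightarrow> 'a) \<Rightarrow> 'v \<Rightarrow> bool" where
  "pointed_labeled_graph A G lab v \<longleftrightarrow>
     fin_digraph G \<and> lab \<in> arcs G \<rightarrow> A \<and> v \<in> verts G"

definition infinite_walks :: "('v, 'e) pre_digraph \<Rightarrow> 'v \<Rightarrow> (nat \<Rightarrow> 'e) set" where
  "infinite_walks G v =
     {e. (\<forall>k. e k \<in> arcs G) \<and> tail G (e 0) = v \<and> (\<forall>k. tail G (e (Suc k)) = head G (e k))}"

definition path_set :: "('v, 'e) pre_digraph \<Rightarrow> ('e \<Rightarrow> 'a) \<Rightarrow> 'v \<Rightarrow> (nat \<Rightarrow> 'a) set" where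
  "path_set G lab v = (\<lambda>e k. lab (e k)) ` infinite_walks G v"

text \<open>
  The residue modulo \<open>p ^ n\<close> of the infinite sum of the \<open>d (a k) * p ^ k\<close> is that of the sum of
  its first \<open>n\<close> terms; convergence to this value is \<open>Zp_of_digits_expansion\<close> below.
\<close>

definition Zp_of_digits :: "nat \<Rightarrow> ('a \<Rightarrow> nat) \<Rightarrow> (nat \<Rightarrow> 'a) \<Rightarrow> nat \<Rightarrow> int" where
  "Zp_of_digits p d a = (\<lambda>n. (\<Sum>k<n. int (d (a k)) * int p ^ k) mod int p ^ n)"

text \<open>
  The alphabet, the graph, its labelling and the digit assignment all vary. Letters, vertices and
  arcs are taken from \<open>nat\<close>; as these sets are finite, this loses no generality, see
  \<open>path_set_fractalsI\<close> below.
\<close>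

definition path_set_fractals :: "nat \<Rightarrow> (nat \<Rightarrow> int) set set" where
  "path_set_fractals p =
     {Zp_of_digits p d ` path_set G lab v |
        (A :: nat set) (d :: nat \<Rightarrow> nat) (G :: (nat, nat) pre_digraph) (lab :: nat \<Rightarrow> nat) (v :: nat).
        finite A \<and> d \<in> A \<rightarrow> {0..<p} \<and> pointed_labeled_graph A G lab v}"


section \<open>Basic properties\<close>

lemma Zp_closedI:
  assumes "p > 0" "\<And>n. [f (Suc n) = f n] (mod int p ^ n)"
  shows "(\<lambda>n. f n mod int p ^ n) \<in> carrier (Zp p)"
proof -
  have "(f (Suc n) mod int p ^ Suc n) mod int p ^ n = f n mod int p ^ n" for n
    using assms(2)[of n] by (simp add: cong_def mod_mod_cancel)
  then show ?thesis using assms(1) by (auto simp: Zp_def)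
qed

lemma Zp_carrierD:
  assumes "x \<in> carrier (Zp p)"
  shows "x n mod int p ^ n = x n" "0 \<le> x n" "x n < int p ^ n"
    "x (Suc n) mod int p ^ n = x n" "[x (Suc n) = x n] (mod int p ^ n)"
proof -
  show "0 \<le> x n" "x n < int p ^ n" "x (Suc n) mod int p ^ n = x n"
    using assms by (auto simp: Zp_def)
  then show "x n mod int p ^ n = x n" "[x (Suc n) = x n] (mod int p ^ n)"
    by (simp_all add: cong_def)
qed

lemma Zp_carrier_mod:
  assumes "x \<in> carrier (Zp p)"
  shows "x (n + k) mod int p ^ n = x n"
proof (induction k)
  case 0
  then show ?case using Zp_carrierD(1)[OF assms] by simp
next
  case (Suc k)
  have "x (n + Suc k) mod int p ^ n = (x (Suc (n + k)) mod int p ^ (n + k)) mod int p ^ n"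
    by (simp add: mod_mod_cancel le_imp_power_dvd)
  also have "\<dots> = x n" using Suc Zp_carrierD(4)[OF assms, of "n + k"] by simp
  finally show ?case .
qed

lemma Zp_simps:
  "(x \<oplus>\<^bsub>Zp p\<^esub> y) n = (x n + y n) mod int p ^ n"
  "(x \<otimes>\<^bsub>Zp p\<^esub> y) n = (x n * y n) mod int p ^ n"
  "\<one>\<^bsub>Zp p\<^esub> n = 1 mod int p ^ n" "\<zero>\<^bsub>Zp p\<^esub> n = 0"
  by (simp_all add: Zp_def)

lemma Zp_closed:
  assumes "p > 0" "x \<in> carrier (Zp p)" "y \<in> carrier (Zp p)"
  shows "x \<oplus>\<^bsub>Zp p\<^esub> y \<in> carrier (Zp p)" "x \<otimes>\<^bsub>Zp p\<^esub> y \<in> carrier (Zp p)"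
proof -
  have eq: "x \<oplus>\<^bsub>Zp p\<^esub> y = (\<lambda>n. (x n + y n) mod int p ^ n)"
    "x \<otimes>\<^bsub>Zp p\<^esub> y = (\<lambda>n. (x n * y n) mod int p ^ n)"
    by (simp_all add: Zp_def)
  show "x \<oplus>\<^bsub>Zp p\<^esub> y \<in> carrier (Zp p)" "x \<otimes>\<^bsub>Zp p\<^esub> y \<in> carrier (Zp p)"
    unfolding eq using assms by (intro Zp_closedI cong_add cong_mult Zp_carrierD(5); simp)+
qed

lemma Zp_of_int_closed: "p > 0 \<Longrightarrow> Zp_of_int p a \<in> carrier (Zp p)"
  unfolding Zp_of_int_def by (rule Zp_closedI) auto

lemma Zp_of_int_simps:
  "Zp_of_int p 0 = \<zero>\<^bsub>Zp p\<^esub>" "Zp_of_int p 1 = \<one>\<^bsub>Zp p\<^esub>"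
  "Zp_of_int p (a + b) = Zp_of_int p a \<oplus>\<^bsub>Zp p\<^esub> Zp_of_int p b"
  "Zp_of_int p (a * b) = Zp_of_int p a \<otimes>\<^bsub>Zp p\<^esub> Zp_of_int p b"
  by (simp_all add: Zp_def Zp_of_int_def mod_simps)

lemma Zp_cring:
  assumes "p > 0"
  shows "cring (Zp p)"
proof (rule cringI)
  have c: "\<zero>\<^bsub>Zp p\<^esub> \<in> carrier (Zp p)" "\<one>\<^bsub>Zp p\<^esub> \<in> carrier (Zp p)"
    using Zp_of_int_closed[OF assms, of 0] Zp_of_int_closed[OF assms, of 1]
    by (simp_all add: Zp_of_int_simps)
  show "abelian_group (Zp p)"
  proof (rule abelian_groupI)
    fix x assume x: "x \<in> carrier (Zp p)"
    show "\<exists>y\<in>carrier (Zp p). y \<oplus>\<^bsub>Zp p\<^esub> x = \<zero>\<^bsub>Zp p\<^esub>"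
    proof (rule bexI)
      show "Zp_of_int p (-1) \<otimes>\<^bsub>Zp p\<^esub> x \<oplus>\<^bsub>Zp p\<^esub> x = \<zero>\<^bsub>Zp p\<^esub>"
        by (rule ext) (simp add: Zp_simps Zp_of_int_def mod_simps)
      show "Zp_of_int p (-1) \<otimes>\<^bsub>Zp p\<^esub> x \<in> carrier (Zp p)"
        using x assms by (intro Zp_closed Zp_of_int_closed)
    qed
  qed (use assms c in \<open>auto intro!: Zp_closed ext simp: Zp_simps mod_simps Zp_carrierD(1) algebra_simps\<close>)
  show "comm_monoid (Zp p)"
    by (rule comm_monoidI)
       (use assms c in \<open>auto intro!: Zp_closed ext simp: Zp_simps mod_simps Zp_carrierD(1) algebra_simps\<close>)
  show "(x \<oplus>\<^bsub>Zp p\<^esub> y) \<otimes>\<^bsub>Zp p\<^esub> z = x \<otimes>\<^bsub>Zp p\<^esub> z \<oplus>\<^bsub>Zp p\<^esub> y \<otimes>\<^bsub>Zp p\<^esub> z" for x y z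
    by (rule ext) (simp add: Zp_simps mod_simps algebra_simps)
qed

lemma Zp_of_int_Units:
  assumes p: "prime p" and b: "\<not> int p dvd b"
  shows "Zp_of_int p b \<in> Units (Zp p)"
proof -
  have p0: "p > 0" using p prime_gt_0_nat by blast
  interpret cring "Zp p" by (rule Zp_cring[OF p0])
  have "coprime (int p) b" using p b by (simp add: prime_imp_coprime)
  then have cop: "coprime b (int p ^ n)" for n by (simp add: coprime_commute)
  then have "\<forall>n. \<exists>y. [b * y = 1] (mod int p ^ n)"
    using cong_solve_coprime_int by blast
  then obtain y where y: "[b * y n = 1] (mod int p ^ n)" for n by metis
  have "[y (Suc n) = y n] (mod int p ^ n)" for n
  proof -
    have "[b * y (Suc n) = 1] (mod int p ^ n)"
      by (rule cong_dvd_modulus[OF y]) (simp add: le_imp_power_dvd)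
    with y[of n] have "[b * y (Suc n) = b * y n] (mod int p ^ n)"
      using cong_sym cong_trans by blast
    then show ?thesis using cop cong_mult_lcancel by blast
  qed
  then have yc: "(\<lambda>n. y n mod int p ^ n) \<in> carrier (Zp p)"
    by (rule Zp_closedI[OF p0])
  have "Zp_of_int p b \<otimes>\<^bsub>Zp p\<^esub> (\<lambda>n. y n mod int p ^ n) = \<one>\<^bsub>Zp p\<^esub>"
    by (rule ext) (use y in \<open>simp add: Zp_simps Zp_of_int_def mod_simps cong_def\<close>)
  moreover from this have "(\<lambda>n. y n mod int p ^ n) \<otimes>\<^bsub>Zp p\<^esub> Zp_of_int p b = \<one>\<^bsub>Zp p\<^esub>"
    by (subst m_comm[OF yc Zp_of_int_closed[OF p0]])
  ultimately show ?thesis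
    using yc Zp_of_int_closed[OF p0, of b] unfolding Units_def by blast
qed

lemma Zp_torsion_free:
  assumes p: "prime p" and x: "x \<in> carrier (Zp p)" and g: "g \<noteq> 0"
    and eq: "Zp_of_int p g \<otimes>\<^bsub>Zp p\<^esub> x = \<zero>\<^bsub>Zp p\<^esub>"
  shows "x = \<zero>\<^bsub>Zp p\<^esub>"
proof
  fix n
  have "\<not> is_unit (int p)" using p by (auto simp: prime_gt_1_nat dest: prime_gt_1_nat)
  with g obtain k u where gu: "g = int p ^ k * u" "\<not> int p dvd u"
    by (metis multiplicity_decompose' mult.commute)
  have "int p ^ (n + k) dvd g * x (n + k)"
    using fun_cong[OF eq, of "n + k"] by (simp add: Zp_simps Zp_of_int_def mod_simps dvd_eq_mod_eq_0)
  then have "int p ^ k * int p ^ n dvd int p ^ k * (u * x (n + k))"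
    by (simp add: gu power_add mult_ac)
  then have d: "int p ^ n dvd u * x (n + k)"
    using p by (auto dest: prime_gt_0_nat)
  have "coprime (int p) u" using p gu by (simp add: prime_imp_coprime)
  then have "coprime (int p ^ n) u" by simp
  with d have "int p ^ n dvd x (n + k)" by (simp add: coprime_dvd_mult_right_iff)
  then show "x n = \<zero>\<^bsub>Zp p\<^esub> n" using Zp_carrier_mod[OF x, of n k] by (simp add: Zp_simps)
qed

text \<open>
  The rational p-adic integers, that is, those which solve \<open>b * x = a\<close> with \<open>b \<noteq> 0\<close>, are precisely
  the images of the p-integral rationals.
\<close>

lemma Zp_rational_iff:
  assumes p: "prime p" and b: "b \<noteq> 0"
  shows "x \<in> carrier (Zp p) \<and> Zp_of_int p b \<otimes>\<^bsub>Zp p\<^esub> x = Zp_of_int p a \<longleftrightarrow>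
         p_integral p (Fract a b) \<and> x = Zp_of_rat p (Fract a b)"
proof -
  have p0: "p > 0" using p prime_gt_0_nat by blast
  interpret cring "Zp p" by (rule Zp_cring[OF p0])
  note cl = Zp_of_int_closed[OF p0]
  obtain c d where cd: "quotient_of (Fract a b) = (c, d)" by fastforce
  have d0: "d > 0" and cop: "coprime c d" and fr: "Fract a b = Fract c d"
    using cd quotient_of_denom_pos quotient_of_coprime Fract_of_int_quotient
      quotient_of_div[OF cd] by auto
  have ad: "a * d = c * b" using fr b d0 by (simp add: eq_rat)
  have red: "Zp_of_int p b \<otimes>\<^bsub>Zp p\<^esub> x = Zp_of_int p a \<longleftrightarrow>
             Zp_of_int p d \<otimes>\<^bsub>Zp p\<^esub> x = Zp_of_int p c" if x: "x \<in> carrier (Zp p)"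
  proof -
    have canc: "u = w" if uw: "u \<in> carrier (Zp p)" "w \<in> carrier (Zp p)" "g \<noteq> 0"
        and e: "Zp_of_int p g \<otimes>\<^bsub>Zp p\<^esub> u = Zp_of_int p g \<otimes>\<^bsub>Zp p\<^esub> w" for g u w
    proof -
      have "Zp_of_int p g \<otimes>\<^bsub>Zp p\<^esub> (u \<ominus>\<^bsub>Zp p\<^esub> w) = \<zero>\<^bsub>Zp p\<^esub>"
        using uw e cl[of g] by (simp add: minus_eq r_distr r_minus r_neg)
      then have "u \<ominus>\<^bsub>Zp p\<^esub> w = \<zero>\<^bsub>Zp p\<^esub>"
        using Zp_torsion_free[OF p _ \<open>g \<noteq> 0\<close>] uw by simp
      moreover have "(u \<ominus>\<^bsub>Zp p\<^esub> w) \<oplus>\<^bsub>Zp p\<^esub> w = u"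
        unfolding minus_eq using uw(1,2) by (simp add: a_assoc l_neg)
      ultimately show ?thesis using l_zero[OF uw(2)] by simp
    qed
    have eqs: "Zp_of_int p d \<otimes>\<^bsub>Zp p\<^esub> (Zp_of_int p b \<otimes>\<^bsub>Zp p\<^esub> x) = Zp_of_int p b \<otimes>\<^bsub>Zp p\<^esub> (Zp_of_int p d \<otimes>\<^bsub>Zp p\<^esub> x)"
      by (rule m_lcomm[OF cl cl x])
    have "d * a = b * c" using ad by (simp only: mult.commute)
    then have eqs': "Zp_of_int p d \<otimes>\<^bsub>Zp p\<^esub> Zp_of_int p a = Zp_of_int p b \<otimes>\<^bsub>Zp p\<^esub> Zp_of_int p c"
      by (simp only: Zp_of_int_simps(4)[symmetric])
    show ?thesis
    proof
      assume e: "Zp_of_int p b \<otimes>\<^bsub>Zp p\<^esub> x = Zp_of_int p a"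
      have "Zp_of_int p b \<otimes>\<^bsub>Zp p\<^esub> (Zp_of_int p d \<otimes>\<^bsub>Zp p\<^esub> x) = Zp_of_int p b \<otimes>\<^bsub>Zp p\<^esub> Zp_of_int p c"
        unfolding eqs[symmetric] e by (rule eqs')
      then show "Zp_of_int p d \<otimes>\<^bsub>Zp p\<^esub> x = Zp_of_int p c"
        using canc[of "Zp_of_int p d \<otimes>\<^bsub>Zp p\<^esub> x" "Zp_of_int p c" b] x cl b by blast
    next
      assume e: "Zp_of_int p d \<otimes>\<^bsub>Zp p\<^esub> x = Zp_of_int p c"
      have "Zp_of_int p d \<otimes>\<^bsub>Zp p\<^esub> (Zp_of_int p b \<otimes>\<^bsub>Zp p\<^esub> x) = Zp_of_int p d \<otimes>\<^bsub>Zp p\<^esub> Zp_of_int p a"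
        unfolding eqs e by (rule eqs'[symmetric])
      then show "Zp_of_int p b \<otimes>\<^bsub>Zp p\<^esub> x = Zp_of_int p a"
        using canc[of "Zp_of_int p b \<otimes>\<^bsub>Zp p\<^esub> x" "Zp_of_int p a" d] x cl d0 by blast
    qed
  qed
  have int: "\<not> int p dvd d" if x: "x \<in> carrier (Zp p)"
    and e: "Zp_of_int p d \<otimes>\<^bsub>Zp p\<^esub> x = Zp_of_int p c"
  proof
    assume pd: "int p dvd d"
    have "d * x 1 mod int p = c mod int p"
      using fun_cong[OF e, of 1] by (simp add: Zp_simps Zp_of_int_def mod_simps)
    with pd have "int p dvd c" by (metis dvd_eq_mod_eq_0 dvd_mult2)
    with pd cop have "is_unit (int p)" using coprime_common_divisor by blast
    then show False using p by (auto dest: prime_gt_1_nat)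
  qed
  have sol: "x \<in> carrier (Zp p) \<and> Zp_of_int p d \<otimes>\<^bsub>Zp p\<^esub> x = Zp_of_int p c \<longleftrightarrow>
      x = Zp_of_int p c \<otimes>\<^bsub>Zp p\<^esub> inv\<^bsub>Zp p\<^esub> Zp_of_int p d" if "\<not> int p dvd d"
  proof -
    have U: "Zp_of_int p d \<in> Units (Zp p)" using Zp_of_int_Units[OF p that] .
    let ?d = "Zp_of_int p d" and ?i = "inv\<^bsub>Zp p\<^esub> Zp_of_int p d"
    have ic: "?i \<in> carrier (Zp p)" and il: "?i \<otimes>\<^bsub>Zp p\<^esub> ?d = \<one>\<^bsub>Zp p\<^esub>"
      and ir: "?d \<otimes>\<^bsub>Zp p\<^esub> ?i = \<one>\<^bsub>Zp p\<^esub>"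
      using U by simp_all
    show ?thesis
    proof safe
      assume x: "x \<in> carrier (Zp p)" and e: "?d \<otimes>\<^bsub>Zp p\<^esub> x = Zp_of_int p c"
      have "x = (?i \<otimes>\<^bsub>Zp p\<^esub> ?d) \<otimes>\<^bsub>Zp p\<^esub> x" using il x by simp
      also have "\<dots> = ?i \<otimes>\<^bsub>Zp p\<^esub> Zp_of_int p c" using ic x cl e by (simp add: m_assoc)
      finally show "x = Zp_of_int p c \<otimes>\<^bsub>Zp p\<^esub> ?i" using ic cl m_comm by metis
    next
      show "Zp_of_int p c \<otimes>\<^bsub>Zp p\<^esub> ?i \<in> carrier (Zp p)" using ic cl by simp
      show "?d \<otimes>\<^bsub>Zp p\<^esub> (Zp_of_int p c \<otimes>\<^bsub>Zp p\<^esub> ?i) = Zp_of_int p c"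
        using ic cl ir by (simp add: m_lcomm)
    qed
  qed
  have iff: "p_integral p (Fract a b) \<and> x = Zp_of_rat p (Fract a b) \<longleftrightarrow> \<not> int p dvd d \<and>
      x = Zp_of_int p c \<otimes>\<^bsub>Zp p\<^esub> inv\<^bsub>Zp p\<^esub> Zp_of_int p d"
    unfolding p_integral_def Zp_of_rat_def cd fst_conv snd_conv by (rule refl)
  show ?thesis
    unfolding iff using red int sol by blast
qed

text \<open>The digit series converges p-adically: its tail from \<open>N\<close> on is divisible by \<open>p ^ N\<close>.\<close>

lemma Zp_of_digits_closed: "p > 0 \<Longrightarrow> Zp_of_digits p d a \<in> carrier (Zp p)"
  unfolding Zp_of_digits_def by (rule Zp_closedI) (auto simp: cong_def)

lemma Zp_of_digits_expansion:
  assumes p: "p > 0"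
  shows "Zp_of_digits p d a =
    Zp_of_int p (\<Sum>k<N. int (d (a k)) * int p ^ k) \<oplus>\<^bsub>Zp p\<^esub>
    Zp_of_int p (int p ^ N) \<otimes>\<^bsub>Zp p\<^esub> Zp_of_digits p d (\<lambda>k. a (N + k))"
proof
  fix n
  let ?t = "\<lambda>k. int (d (a k)) * int p ^ k"
  have "(\<Sum>k<N + n. ?t k) = (\<Sum>k<N. ?t k) + (\<Sum>k<n. ?t (N + k))"
    by (induction n) (simp_all add: add.assoc)
  moreover have "(\<Sum>k<N + n. ?t k) = (\<Sum>k<n + N. ?t k)" by (simp add: add.commute)
  moreover have "(\<Sum>k<n + N. ?t k) mod int p ^ n = (\<Sum>k<n. ?t k) mod int p ^ n"
    using Zp_carrier_mod[OF Zp_of_digits_closed[OF p], of d a n N]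
    by (simp add: Zp_of_digits_def mod_mod_cancel le_imp_power_dvd)
  moreover have "(\<Sum>k<n. ?t (N + k)) = int p ^ N * (\<Sum>k<n. int (d (a (N + k))) * int p ^ k)"
    by (simp add: sum_distrib_left power_add mult_ac)
  ultimately show "Zp_of_digits p d a n =
    (Zp_of_int p (\<Sum>k<N. ?t k) \<oplus>\<^bsub>Zp p\<^esub>
     Zp_of_int p (int p ^ N) \<otimes>\<^bsub>Zp p\<^esub> Zp_of_digits p d (\<lambda>k. a (N + k))) n"
    by (simp add: Zp_simps Zp_of_int_def Zp_of_digits_def mod_simps)
qed

lemma path_set_fractalsI:
  fixes A :: "'a set" and G :: "('v, 'e) pre_digraph"
  assumes A: "finite A" and d: "d \<in> A \<rightarrow> {0..<p}" and G: "pointed_labeled_graph A G lab v"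
  shows "Zp_of_digits p d ` path_set G lab v \<in> path_set_fractals p"
proof -
  interpret fin_digraph G using G by (simp add: pointed_labeled_graph_def)
  have v: "v \<in> verts G" and lab: "lab \<in> arcs G \<rightarrow> A"
    using G by (auto simp: pointed_labeled_graph_def)
  obtain \<alpha> :: "'a \<Rightarrow> nat" where \<alpha>: "inj_on \<alpha> A"
    using finite_imp_inj_to_nat_seg[OF A] by blast
  obtain \<nu> :: "'v \<Rightarrow> nat" where \<nu>: "inj_on \<nu> (verts G)"
    using finite_imp_inj_to_nat_seg[OF finite_verts] by blast
  obtain \<epsilon> :: "'e \<Rightarrow> nat" where \<epsilon>: "inj_on \<epsilon> (arcs G)"
    using finite_imp_inj_to_nat_seg[OF finite_arcs] by blast
  define \<epsilon>' where "\<epsilon>' = the_inv_into (arcs G) \<epsilon>"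
  have \<epsilon>'1: "\<epsilon>' (\<epsilon> e) = e" if "e \<in> arcs G" for e
    unfolding \<epsilon>'_def using \<epsilon> that by (rule the_inv_into_f_f)
  define H where "H = \<lparr>verts = \<nu> ` verts G, arcs = \<epsilon> ` arcs G,
    tail = (\<lambda>i. \<nu> (tail G (\<epsilon>' i))), head = (\<lambda>i. \<nu> (head G (\<epsilon>' i)))\<rparr>"
  define lab' where "lab' = (\<lambda>i. \<alpha> (lab (\<epsilon>' i)))"
  define d' where "d' = (\<lambda>i. d (the_inv_into A \<alpha> i))"
  have d'1: "d' (\<alpha> x) = d x" if "x \<in> A" for x
    unfolding d'_def using the_inv_into_f_f[OF \<alpha> that] by simp
  have walks: "infinite_walks H (\<nu> v) = (\<lambda>e k. \<epsilon> (e k)) ` infinite_walks G v"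
  proof (intro equalityI subsetI)
    fix f assume f: "f \<in> infinite_walks H (\<nu> v)"
    define e where "e = (\<lambda>k. \<epsilon>' (f k))"
    have e: "e k \<in> arcs G" "f k = \<epsilon> (e k)" for k
    proof -
      have "f k \<in> \<epsilon> ` arcs G" using f by (simp add: infinite_walks_def H_def)
      then obtain e0 where "e0 \<in> arcs G" "f k = \<epsilon> e0" by blast
      then show "e k \<in> arcs G" "f k = \<epsilon> (e k)" by (simp_all add: e_def \<epsilon>'1)
    qed
    have "\<nu> (tail G (e 0)) = \<nu> v" "\<nu> (tail G (e (Suc k))) = \<nu> (head G (e k))" for k
      using f by (simp_all add: infinite_walks_def H_def e_def)
    then have "tail G (e 0) = v" "tail G (e (Suc k)) = head G (e k)" for k
      using inj_onD[OF \<nu>, of "tail G (e 0)" v]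
        inj_onD[OF \<nu>, of "tail G (e (Suc k))" "head G (e k)"] v e(1) by simp_all
    then have "e \<in> infinite_walks G v" using e by (simp add: infinite_walks_def)
    moreover have "f = (\<lambda>k. \<epsilon> (e k))" using e by auto
    ultimately show "f \<in> (\<lambda>e k. \<epsilon> (e k)) ` infinite_walks G v" by blast
  next
    fix f assume "f \<in> (\<lambda>e k. \<epsilon> (e k)) ` infinite_walks G v"
    then show "f \<in> infinite_walks H (\<nu> v)" by (auto simp: infinite_walks_def H_def \<epsilon>'1)
  qed
  have "Zp_of_digits p d' ` path_set H lab' (\<nu> v) = Zp_of_digits p d ` path_set G lab v"
    unfolding path_set_def walks image_image
  proof (rule image_cong[OF refl])
    fix e assume "e \<in> infinite_walks G v"
    then have "e k \<in> arcs G" for k by (simp add: infinite_walks_def)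
    then show "Zp_of_digits p d' (\<lambda>k. lab' (\<epsilon> (e k))) = Zp_of_digits p d (\<lambda>k. lab (e k))"
      using lab by (simp add: Zp_of_digits_def lab'_def \<epsilon>'1 d'1 Pi_iff)
  qed
  moreover have "finite (\<alpha> ` A)" using A by simp
  moreover have "d' \<in> \<alpha> ` A \<rightarrow> {0..<p}" using d by (auto simp: d'1)
  moreover have "pointed_labeled_graph (\<alpha> ` A) H lab' (\<nu> v)"
    unfolding pointed_labeled_graph_def
  proof (intro conjI)
    show "fin_digraph H" by unfold_locales (auto simp: H_def \<epsilon>'1)
    show "lab' \<in> arcs H \<rightarrow> \<alpha> ` A" using lab by (auto simp: H_def lab'_def \<epsilon>'1)
    show "\<nu> v \<in> verts H" using v by (simp add: H_def)
  qed
  ultimately show ?thesis unfolding path_set_fractals_def mem_Collect_eq by metis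
qed

end

theory Submission
  imports Defs
begin

text \<open>
  Write \<open>r = a / b\<close> in lowest terms, so that \<open>b\<close> is invertible modulo \<open>p\<close>. Adding a rational
  \<open>s / b\<close> to a p-adic integer \<open>y\<close> can be done digit by digit, from the lowest digit on, by a machine
  whose memory is the integer \<open>s\<close>. If \<open>y = x + p * y'\<close> with a digit \<open>x\<close>, there is exactly
  one digit \<open>z\<close> with \<open>b * z = b * x + s\<close> modulo \<open>p\<close>, and then
  \<open>y + s / b = z + p * (y' + s' / b)\<close> where \<open>s' = (s + b * (x - z)) / p\<close>
  is again an integer. The machine writes \<open>z\<close> and goes on with \<open>y'\<close> and \<open>s'\<close>. The denominator
  stays \<open>b\<close>, and as \<open>\<bar>x - z\<bar> < p\<close>, the bound \<open>\<bar>s\<bar> \<le> M\<close> is inherited by \<open>s'\<close> as soon as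
  \<open>b \<le> M\<close>. Hence finitely many states suffice. Carries and the digits of \<open>r\<close> need no
  separate treatment, since the numerator \<open>s\<close> records both of them (\<open>adder_run\<close>).

  On the other hand, every map of p-adic integers that is computed by a finite-state machine on the
  digits sends path set fractals to path set fractals, because the product of the graph with the
  states of the machine presents the image (\<open>path_set_fractals_transducer\<close>).
\<close>

section \<open>Finite-state maps on digit sequences\<close>

primrec run :: "('s \<Rightarrow> nat \<Rightarrow> 's) \<Rightarrow> 's \<Rightarrow> (nat \<Rightarrow> nat) \<Rightarrow> nat \<Rightarrow> 's" where
  "run nxt s x 0 = s"
| "run nxt s x (Suc k) = nxt (run nxt s x k) (x k)"

text \<open>
  In the product graph an arc \<open>(e, s)\<close> is the arc \<open>e\<close> passed while the machine is in state \<open>s\<close>; its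
  label is the digit then written. The machine is deterministic, so the walks of the
  product are the walks of the given graph, each paired with its only run.
\<close>

lemma path_set_fractals_transducer:
  fixes S :: "'s set"
  assumes S: "finite S" "s0 \<in> S"
    and nxt: "\<And>s x. s \<in> S \<Longrightarrow> x < p \<Longrightarrow> nxt s x \<in> S"
    and out: "\<And>s x. s \<in> S \<Longrightarrow> x < p \<Longrightarrow> out s x < p"
    and \<Phi>: "\<And>x. (\<And>k. x k < p) \<Longrightarrow>
      \<Phi> (Zp_of_digits p id x) = Zp_of_digits p id (\<lambda>k. out (run nxt s0 x k) (x k))"
    and Y: "Y \<in> path_set_fractals p"
  shows "\<Phi> ` Y \<in> path_set_fractals p"
proof -
  obtain A :: "nat set" and d :: "nat \<Rightarrow> nat" and G :: "(nat, nat) pre_digraph"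
      and lab :: "nat \<Rightarrow> nat" and v
    where Y_eq: "Y = Zp_of_digits p d ` path_set G lab v"
      and d: "d \<in> A \<rightarrow> {0..<p}" and G: "pointed_labeled_graph A G lab v"
    using Y unfolding path_set_fractals_def by blast
  interpret fin_digraph G using G by (simp add: pointed_labeled_graph_def)
  define D where "D e = d (lab e)" for e
  have D: "D e < p" if "e \<in> arcs G" for e
    using that d G by (auto simp: D_def pointed_labeled_graph_def Pi_iff)
  define H where "H = \<lparr>verts = verts G \<times> S, arcs = arcs G \<times> S,
    tail = (\<lambda>(e, s). (tail G e, s)), head = (\<lambda>(e, s). (head G e, nxt s (D e)))\<rparr>"
  define lab' where "lab' = (\<lambda>(e, s). out s (D e))"
  let ?\<sigma> = "\<lambda>e. run nxt s0 (\<lambda>k. D (e k))"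
  have walks: "infinite_walks H (v, s0) = (\<lambda>e k. (e k, ?\<sigma> e k)) ` infinite_walks G v"
  proof (intro equalityI subsetI)
    fix f assume f: "f \<in> infinite_walks H (v, s0)"
    define e where "e = (\<lambda>k. fst (f k))"
    have e: "e \<in> infinite_walks G v"
      using f by (auto simp: infinite_walks_def H_def e_def case_prod_beta mem_Times_iff)
    have "snd (f k) = ?\<sigma> e k" for k
      using f by (induction k) (auto simp: infinite_walks_def H_def e_def case_prod_beta)
    then have "f = (\<lambda>k. (e k, ?\<sigma> e k))" by (auto simp: e_def prod_eq_iff)
    with e show "f \<in> (\<lambda>e k. (e k, ?\<sigma> e k)) ` infinite_walks G v" by blast
  next
    fix f assume "f \<in> (\<lambda>e k. (e k, ?\<sigma> e k)) ` infinite_walks G v"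
    then obtain e where e: "e \<in> infinite_walks G v" and f: "f = (\<lambda>k. (e k, ?\<sigma> e k))" by blast
    have arcs: "e k \<in> arcs G" for k using e by (simp add: infinite_walks_def)
    have "?\<sigma> e k \<in> S" for k by (induction k) (use S nxt D arcs in auto)
    then show "f \<in> infinite_walks H (v, s0)" using e by (auto simp: infinite_walks_def H_def f)
  qed
  have "\<Phi> ` Y = Zp_of_digits p id ` path_set H lab' (v, s0)"
    unfolding Y_eq path_set_def walks image_image
  proof (rule image_cong[OF refl])
    fix e assume "e \<in> infinite_walks G v"
    then have "D (e k) < p" for k using D by (simp add: infinite_walks_def)
    then have "\<Phi> (Zp_of_digits p id (\<lambda>k. D (e k))) =
        Zp_of_digits p id (\<lambda>k. out (?\<sigma> e k) (D (e k)))"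
      by (rule \<Phi>)
    moreover have "Zp_of_digits p id (\<lambda>k. D (e k)) = Zp_of_digits p d (\<lambda>k. lab (e k))"
      by (simp add: Zp_of_digits_def D_def)
    ultimately show "\<Phi> (Zp_of_digits p d (\<lambda>k. lab (e k))) =
        Zp_of_digits p id (\<lambda>k. lab' (e k, ?\<sigma> e k))"
      by (simp add: lab'_def)
  qed
  moreover have "pointed_labeled_graph {0..<p} H lab' (v, s0)"
    unfolding pointed_labeled_graph_def
  proof (intro conjI)
    show "fin_digraph H" by unfold_locales (auto simp: H_def S nxt D)
    show "lab' \<in> arcs H \<rightarrow> {0..<p}" by (auto simp: H_def lab'_def out D)
    show "(v, s0) \<in> verts H" using G S by (simp add: H_def pointed_labeled_graph_def)
  qed
  ultimately show ?thesis
    using path_set_fractalsI[of "{0..<p}" id p H lab' "(v, s0)"] by simp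
qed


section \<open>Adding a rational number digit by digit\<close>

text \<open>
  In both functions \<open>c\<close> stands for an inverse of \<open>b\<close> modulo \<open>p\<close>, so that
  \<open>x + s * c\<close> is the residue of \<open>x + s / b\<close>.
\<close>

definition adder_out :: "nat \<Rightarrow> int \<Rightarrow> int \<Rightarrow> nat \<Rightarrow> nat" where
  "adder_out p c s x = nat ((int x + s * c) mod int p)"

definition adder_next :: "nat \<Rightarrow> int \<Rightarrow> int \<Rightarrow> int \<Rightarrow> nat \<Rightarrow> int" where
  "adder_next p b c s x = (s + b * (int x - int (adder_out p c s x))) div int p"

lemma adder_out_less: "p > 0 \<Longrightarrow> adder_out p c s x < p"
  by (simp add: adder_out_def nat_less_iff)

lemma adder_step:
  assumes p: "p > 0" and c: "[b * c = 1] (mod int p)"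
  shows "b * int (adder_out p c s x) + int p * adder_next p b c s x = b * int x + s"
proof -
  let ?z = "int (adder_out p c s x)"
  have z: "?z = (int x + s * c) mod int p" using p by (simp add: adder_out_def)
  have "[b * ?z = b * (int x + s * c)] (mod int p)"
    unfolding z by (intro cong_mult cong_refl) (simp add: cong_def)
  also have "b * (int x + s * c) = b * int x + s * (b * c)" by (simp add: algebra_simps)
  also have "[b * int x + s * (b * c) = b * int x + s * 1] (mod int p)"
    by (intro cong_add cong_mult cong_refl c)
  finally have "int p dvd b * int x + s - b * ?z"
    by (simp add: cong_iff_dvd_diff dvd_diff_commute)
  then have "int p dvd s + b * (int x - ?z)" by (simp add: algebra_simps)
  then have "int p * adder_next p b c s x = s + b * (int x - ?z)"
    by (simp add: adder_next_def)
  then show ?thesis by (simp add: algebra_simps)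
qed

text \<open>
  The new state is at most \<open>(M + b * (p - 1)) / p\<close> in absolute value, a weighted mean of \<open>M\<close>
  and \<open>b\<close>.
\<close>

lemma adder_next_bound:
  assumes p: "p > 0" and c: "[b * c = 1] (mod int p)" and b: "0 \<le> b" "b \<le> M"
    and s: "\<bar>s\<bar> \<le> M" and x: "x < p"
  shows "\<bar>adder_next p b c s x\<bar> \<le> M"
proof -
  let ?z = "int (adder_out p c s x)"
  have "int p * \<bar>adder_next p b c s x\<bar> = \<bar>int p * adder_next p b c s x\<bar>" by (simp add: abs_mult)
  also have "int p * adder_next p b c s x = s + b * (int x - ?z)"
    using adder_step[OF p c, of s x] by (simp add: algebra_simps)
  also have "\<bar>s + b * (int x - ?z)\<bar> \<le> \<bar>s\<bar> + b * \<bar>int x - ?z\<bar>"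
    using b abs_triangle_ineq[of s "b * (int x - ?z)"] by (simp add: abs_mult)
  also have "\<dots> \<le> M + M * (int p - 1)"
    using s b x adder_out_less[OF p, of c s x] by (intro add_mono mult_mono) auto
  also have "\<dots> = int p * M" by (simp add: algebra_simps)
  finally show ?thesis using p by simp
qed

text \<open>
  The state after \<open>n\<close> steps is what remains to be added above the first \<open>n\<close> digits; it vanishes
  modulo \<open>p ^ n\<close>.
\<close>

lemma adder_run:
  fixes x :: "nat \<Rightarrow> nat" and s :: int
  assumes p: "p > 0" and c: "[b * c = 1] (mod int p)"
  defines "\<sigma> \<equiv> run (adder_next p b c) s x"
  shows "b * (\<Sum>k<n. int (adder_out p c (\<sigma> k) (x k)) * int p ^ k) + int p ^ n * \<sigma> n =
    b * (\<Sum>k<n. int (x k) * int p ^ k) + s"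
proof (induction n)
  case 0
  then show ?case by (simp add: \<sigma>_def)
next
  case (Suc n)
  let ?z = "\<lambda>k. int (adder_out p c (\<sigma> k) (x k))"
  have "b * (\<Sum>k<Suc n. ?z k * int p ^ k) + int p ^ Suc n * \<sigma> (Suc n) =
      b * (\<Sum>k<n. ?z k * int p ^ k) + int p ^ n * (b * ?z n + int p * \<sigma> (Suc n))"
    by (simp add: algebra_simps)
  also have "b * ?z n + int p * \<sigma> (Suc n) = b * int (x n) + \<sigma> n"
    using adder_step[OF p c] by (simp add: \<sigma>_def)
  also have "b * (\<Sum>k<n. ?z k * int p ^ k) + int p ^ n * (b * int (x n) + \<sigma> n) =
      (b * (\<Sum>k<n. ?z k * int p ^ k) + int p ^ n * \<sigma> n) + b * (int (x n) * int p ^ n)"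
    by (simp add: algebra_simps)
  also have "\<dots> = b * (\<Sum>k<Suc n. int (x k) * int p ^ k) + s"
    unfolding Suc.IH by (simp add: algebra_simps)
  finally show ?case .
qed

lemma p_integral_coprime:
  assumes "prime p" "p_integral p r" "quotient_of r = (a, b)"
  shows "coprime b (int p)"
proof -
  have "coprime (int p) b" using assms by (simp add: p_integral_def prime_imp_coprime)
  then show ?thesis by (simp add: coprime_commute)
qed

text \<open>Both sides agree after multiplication by \<open>b\<close>, which is invertible modulo \<open>p ^ n\<close>.\<close>

lemma Zp_of_digits_adder:
  fixes x :: "nat \<Rightarrow> nat"
  assumes p: "prime p" and r: "p_integral p r" and q: "quotient_of r = (a, b)"
    and c: "[b * c = 1] (mod int p)"
  shows "Zp_of_digits p id x \<oplus>\<^bsub>Zp p\<^esub> Zp_of_rat p r =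
    Zp_of_digits p id (\<lambda>k. adder_out p c (run (adder_next p b c) a x k) (x k))"
proof
  fix n
  let ?\<sigma> = "run (adder_next p b c) a x"
  let ?X = "\<Sum>k<n. int (x k) * int p ^ k"
  let ?Z = "\<Sum>k<n. int (adder_out p c (?\<sigma> k) (x k)) * int p ^ k"
  let ?R = "Zp_of_rat p r n"
  have p0: "p > 0" using p prime_gt_0_nat by blast
  have b0: "b \<noteq> 0" using quotient_of_denom_pos[OF q] by simp
  have "r = Fract a b" using quotient_of_div[OF q] by (simp add: Fract_of_int_quotient)
  then have "Zp_of_int p b \<otimes>\<^bsub>Zp p\<^esub> Zp_of_rat p r = Zp_of_int p a"
    using Zp_rational_iff[OF p b0, of "Zp_of_rat p r" a] r by simp
  from fun_cong[OF this, of n] have R: "[b * ?R = a] (mod int p ^ n)"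
    by (simp add: Zp_simps Zp_of_int_def cong_def mod_simps)
  have "[b * ?Z = b * ?Z + int p ^ n * ?\<sigma> n] (mod int p ^ n)" by (simp add: cong_def)
  also have "b * ?Z + int p ^ n * ?\<sigma> n = b * ?X + a" by (rule adder_run[OF p0 c])
  also have "[b * ?X + a = b * ?X + b * ?R] (mod int p ^ n)"
    by (intro cong_add cong_refl cong_sym[OF R])
  finally have "[b * ?Z = b * (?X + ?R)] (mod int p ^ n)" by (simp add: distrib_left)
  moreover have "coprime b (int p ^ n)" using p_integral_coprime[OF p r q] by simp
  ultimately have "[?Z = ?X + ?R] (mod int p ^ n)" by (simp add: cong_mult_lcancel)
  then show "(Zp_of_digits p id x \<oplus>\<^bsub>Zp p\<^esub> Zp_of_rat p r) n =
      Zp_of_digits p id (\<lambda>k. adder_out p c (?\<sigma> k) (x k)) n"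
    by (simp add: Zp_simps Zp_of_digits_def cong_def mod_simps)
qed

theorem theorem1p2:
  fixes p :: nat and Y :: "(nat \<Rightarrow> int) set" and r :: rat
  assumes "prime p"
    and "Y \<in> path_set_fractals p"
    and "p_integral p r"
  shows "{y \<oplus>\<^bsub>Zp p\<^esub> Zp_of_rat p r | y. y \<in> Y} \<in> path_set_fractals p"
proof -
  have p0: "p > 0" using assms(1) prime_gt_0_nat by blast
  obtain a b where q: "quotient_of r = (a, b)" by fastforce
  have b: "b > 0" using quotient_of_denom_pos[OF q] .
  obtain c where c: "[b * c = 1] (mod int p)"
    using cong_solve_coprime_int[OF p_integral_coprime[OF assms(1,3) q]] by blast
  \<comment> \<open>The states stay bounded by any \<open>M\<close> that is at least \<open>b\<close>; the initial state needs \<open>M \<ge> \<bar>a\<bar>\<close>.\<close>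
  define M where "M = \<bar>a\<bar> + b"
  have "(\<lambda>y. y \<oplus>\<^bsub>Zp p\<^esub> Zp_of_rat p r) ` Y \<in> path_set_fractals p"
  proof (rule path_set_fractals_transducer[of "{-M..M}" a p "adder_next p b c" "adder_out p c"])
    show "a \<in> {-M..M}" using b by (auto simp: M_def)
    show "adder_next p b c s x \<in> {-M..M}" if "s \<in> {-M..M}" "x < p" for s x
      using adder_next_bound[OF p0 c, of M s x] that b by (auto simp: M_def abs_le_iff)
  qed (use assms(2) adder_out_less[OF p0] Zp_of_digits_adder[OF assms(1,3) q c] in auto)
  then show ?thesis by (simp add: Setcompr_eq_image)
qed

end
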